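(* (Fully cognitive charger, noiseless channel, as a Markov decision process.) In the setting of the context, assume the set $\mathcal B$ of reachable battery states is finite. For $\rho\ge0$ let $$J_M(\rho)=\sup_{\substack{\{p(x_t,e_t|x^{t-1},e^{t-1})\}_{t=1}^\infty:\\(\mathbf X,\mathbf E)\in\mathcal A'_\infty\text{ a.s.}}}\liminf_{n\to\infty}\frac1n\Big(H(X^n)-\rho\sum_{t=1}^n\mathbb E[E_t]\Big).$$ Then the supremum is unchanged if restricted to conditional distributions of the form $p(x_t,e_t|x^{t-1},e^{t-1})=p(x_t,e_t|x^{t-1},b_t)$, where $b_t$ is the battery state determined by $(x^{t-1},e^{t-1})$, and $J_M(\rho)$ equals the optimal infinite-horizon expected average reward $$\sup_\pi\liminf_{n\to\infty}\frac1n\sum_{t=1}^n\mathbb E[g(\mathbf s_t,\mathbf u_t)]$$ of the following Markov decision process. - State: $\mathbf s_t=[s_t(b):b\in\mathcal B]$, a probability distribution on $\mathcal B$; initial state $s_1(b)=1\{b=\bar B\}$. - Action: $\mathbf u_t=[u_t(x,e|b)]$, a conditional probability distribution on $\mathcal X\times\mathcal E$ given $b\in\mathcal B$, with $u_t(x,e|b)=0$ whenever $\phi(x)>\min\{b+e,\bar B\}$. - Disturbance: $w_t\in\mathcal X$, with conditional distribution $P(w_t=w\mid\mathbf s_t,\mathbf u_t)=\sum_{e,b}s_t(b)u_t(w,e|b)$. - State dynamics: $$s_{t+1}(b')=\frac{\sum_{e,b}s_t(b)u_t(w_t,e|b)\,1\{b'=\min\{b+e,\bar B\}-\phi(w_t)\}}{\sum_{e,b}s_t(b)u_t(w_t,e|b)}.$$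 - Reward: $$g(\mathbf s,\mathbf u)=\sum_{x,e,b}s(b)u(x,e|b)\Big(-\log\sum_{e',b'}s(b')u(x,e'|b')-\rho e\Big).$$ Here $\pi=\{\mu_1,\mu_2,\dots\}$ ranges over all policies, $\mathbf u_t=\mu_t(w^{t-1})$ being a function of the past disturbances.
   Context: $\mathcal X$ and $\mathcal E$ are finite; $\phi:\mathcal X\to[0,\infty)$; $\bar B$ is the battery capacity; $\mathcal E\subseteq[0,\bar B]$ contains a strictly positive element; $\phi(x)\le\bar B$ for all $x\in\mathcal X$; there is $0\in\mathcal X$ with $\phi(0)=0$. $H$ is Shannon entropy, logarithms to base 2, $0\log0=0$. $\mathcal A'_n$ is the set of pairs $(x^n,e^n)\in\mathcal X^n\times\mathcal E^n$ such that, with $b_1=\bar B$ and $b_{t+1}=\min\{b_t+e_t,\bar B\}-\phi(x_t)$, one has $\phi(x_t)\le\min\{b_t+e_t,\bar B\}$ for $t=1,\dots,n$. For infinite sequences, $(\mathbf x,\mathbf e)\in\mathcal A'_\infty$ means $(x^n,e^n)\in\mathcal A'_n$ for every $n\ge1$. $\mathcal B$ is the set of all battery levels that can be reached from $b_1=\bar B$ by some finite feasible pair $(x^n,e^n)\in\mathcal A'_n$. *)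

theory Defs
  imports "HOL-Probability.Probability"
begin

definition distribution_on :: "'a set \<Rightarrow> ('a \<Rightarrow> real) \<Rightarrow> bool" where
  "distribution_on A f \<longleftrightarrow> (\<forall>a\<in>A. 0 \<le> f a) \<and> (\<Sum>a\<in>A. f a) = 1"

text \<open>\<open>k h a\<close> is the conditional probability that the next letter is \<open>a\<close>, given that the
  past letters (oldest first) form the list \<open>h\<close>.\<close>

definition causal_kernel :: "'a set \<Rightarrow> ('a list \<Rightarrow> 'a \<Rightarrow> real) \<Rightarrow> bool" where
  "causal_kernel A k \<longleftrightarrow> (\<forall>h\<in>lists A. distribution_on A (k h))"

abbreviation step_measure :: "'a set \<Rightarrow> ('a list \<Rightarrow> 'a \<Rightarrow> real) \<Rightarrow> nat \<Rightarrow> (nat \<Rightarrow> 'a) \<Rightarrow> 'a measure"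
  where "step_measure A k t \<omega> \<equiv> point_measure A (k (map \<omega> [0..<t]))"

text \<open>The Ionescu-Tulcea law of the infinite sequence. Sequences are indexed from \<open>0\<close>, so the
  letter at time \<open>t = 1, 2, \<dots>\<close> is \<open>\<omega> (t - 1)\<close>.\<close>

definition path_law :: "'a set \<Rightarrow> ('a list \<Rightarrow> 'a \<Rightarrow> real) \<Rightarrow> (nat \<Rightarrow> 'a) measure" where
  "path_law A k =
     projective_family.lim UNIV
       (Ionescu_Tulcea.CI (step_measure A k) (\<lambda>_. count_space A)) (\<lambda>_. count_space A)"

lemma prob_space_point_measure_distribution:
  assumes "finite A" "distribution_on A f"
  shows "prob_space (point_measure A f)"
proof (rule prob_spaceI)
  have "(\<Sum>a\<in>A. ennreal (f a)) = ennreal (\<Sum>a\<in>A. f a)"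
    using assms by (intro sum_ennreal) (auto simp: distribution_on_def)
  then show "emeasure (point_measure A f) (space (point_measure A f)) = 1"
    using assms by (simp add: emeasure_point_measure_finite space_point_measure distribution_on_def)
qed

lemma sets_PiM_count_space:
  assumes "finite A" "finite J"
  shows "sets (PiM J (\<lambda>_. count_space A)) = Pow (PiE J (\<lambda>_. A))"
  using count_space_PiM_finite[of J "\<lambda>_. A"] assms by (simp add: countable_finite)

lemma Ionescu_Tulcea_step_measure:
  assumes A: "finite A" and k: "causal_kernel A k"
  shows "Ionescu_Tulcea (step_measure A k) (\<lambda>_. count_space A)"
proof -
  have ps: "prob_space (step_measure A k i x)"
    if "x \<in> space (PiM {0..<i} (\<lambda>_. count_space A))" for i x
  proof (rule prob_space_point_measure_distribution[OF A])
    have "map x [0..<i] \<in> lists A" using that by (auto simp: space_PiM PiE_iff)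
    then show "distribution_on A (k (map x [0..<i]))" using k by (auto simp: causal_kernel_def)
  qed
  have meas: "step_measure A k i \<in>
      measurable (PiM {0..<i} (\<lambda>_. count_space A)) (subprob_algebra (count_space A))" for i
  proof -
    have "sets (PiM {0..<i} (\<lambda>_. count_space A)) = sets (count_space (PiE {0..<i} (\<lambda>_. A)))"
      using A by (simp add: sets_PiM_count_space)
    then have "measurable (PiM {0..<i} (\<lambda>_. count_space A)) (subprob_algebra (count_space A))
        = measurable (count_space (PiE {0..<i} (\<lambda>_. A))) (subprob_algebra (count_space A))"
      by (rule measurable_cong_sets) (rule refl)
    moreover have "step_measure A k i \<in>
        measurable (count_space (PiE {0..<i} (\<lambda>_. A))) (subprob_algebra (count_space A))"
      using ps by (auto simp: space_subprob_algebra sets_point_measure space_PiM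
          intro: prob_space_imp_subprob_space)
    ultimately show ?thesis by (simp only:)
  qed
  show ?thesis
    using meas ps by (rule Ionescu_Tulcea.intro)
qed

lemma
  assumes A: "finite A" and k: "causal_kernel A k"
  shows prob_space_path_law: "prob_space (path_law A k)"
    and sets_path_law: "sets (path_law A k) = sets (PiM UNIV (\<lambda>_. count_space A))"
    and space_path_law: "space (path_law A k) = (UNIV \<rightarrow> A)"
    and measure_path_law_prefix:
      "\<And>h. set h \<subseteq> A \<Longrightarrow>
         measure (path_law A k) {\<omega> \<in> space (path_law A k). map \<omega> [0..<length h] = h}
           = (\<Prod>t<length h. k (take t h) (h ! t))"
proof -
  interpret Ionescu_Tulcea "step_measure A k" "\<lambda>_. count_space A"
    by (rule Ionescu_Tulcea_step_measure[OF A k])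
  let ?M = "\<lambda>_::nat. count_space A"
  have law: "path_law A k = PF.lim" by (simp add: path_law_def)
  show "sets (path_law A k) = sets (PiM UNIV ?M)"
    unfolding law by simp
  show sp: "space (path_law A k) = (UNIV \<rightarrow> A)"
    unfolding law by (auto simp: space_PiM PiE_iff Pi_iff)
  have "emeasure PF.lim (PF.emb UNIV {} (space (PiM {} ?M))) = emeasure (CI {}) (space (PiM {} ?M))"
    by (rule lim) auto
  also have "\<dots> = 1"
    using prob_space.emeasure_space_1[OF PF.prob_space_P[of "{}"]] by (simp add: PF.space_P)
  also have "PF.emb UNIV {} (space (PiM {} ?M)) = space PF.lim"
    by (auto simp: prod_emb_def space_PiM)
  finally show ps: "prob_space (path_law A k)"
    unfolding law by (intro prob_spaceI)
  have C: "emeasure (C 0 n (\<lambda>x. undefined)) {x} = ennreal (\<Prod>t<n. k (map x [0..<t]) (x t))"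
    if "x \<in> PiE {0..<n} (\<lambda>_. A)" for n x
    using that
  proof (induction n arbitrary: x)
    case 0
    then show ?case by (simp add: emeasure_return PiM_empty)
  next
    case (Suc n)
    define y where "y = restrict x {0..<n}"
    have y: "y \<in> PiE {0..<n} (\<lambda>_. A)" using Suc.prems by (auto simp: y_def PiE_iff)
    have xn: "x n \<in> A" using Suc.prems by (auto simp: PiE_iff)
    have x_eq: "x = y(n := x n)"
      using Suc.prems by (auto simp: y_def PiE_iff fun_eq_iff extensional_def less_Suc_eq)
    have mem: "{x} \<in> sets (PiM {0..<Suc n} ?M)"
      using Suc.prems A by (simp add: sets_PiM_count_space)
    have sC: "space (C 0 n (\<lambda>x. undefined)) = PiE {0..<n} (\<lambda>_. A)"
      by (subst space_C) (auto simp: space_PiM)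
    have ssC: "sets (C 0 n (\<lambda>x. undefined)) = Pow (PiE {0..<n} (\<lambda>_. A))"
      by (subst sets_C) (auto simp: space_PiM sets_PiM_count_space A)
    have hist: "map y [0..<n] = map x [0..<n]" by (simp add: y_def)
    have nn: "0 \<le> k (map x [0..<t]) (x t)" if "t < Suc n" for t
    proof -
      have "map x [0..<t] \<in> lists A" "x t \<in> A"
        using Suc.prems that by (auto simp: PiE_iff)
      then show ?thesis using k by (auto simp: causal_kernel_def distribution_on_def)
    qed
    have eP: "emeasure (eP n \<omega>) {x} = ennreal (k (map x [0..<n]) (x n)) * indicator {y} \<omega>"
      if "\<omega> \<in> PiE {0..<n} (\<lambda>_. A)" for \<omega>
    proof -
      have "emeasure (eP n \<omega>) {x} =
          emeasure (step_measure A k n \<omega>) ((\<lambda>a. fun_upd \<omega> n a) -` {x} \<inter> A)"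
        using that mem by (subst emeasure_eP) (auto simp: space_PiM)
      also have "(\<lambda>a. fun_upd \<omega> n a) -` {x} \<inter> A = (if \<omega> = y then {x n} else {})"
      proof -
        have "\<omega> = y" if "fun_upd \<omega> n a = x" for a
        proof (rule ext)
          show "\<omega> j = y j" for j
            using fun_cong[OF that, of j] \<open>\<omega> \<in> _\<close>
            by (auto simp: y_def PiE_iff extensional_def split: if_splits)
        qed
        moreover have "a = x n" if "fun_upd \<omega> n a = x" for a
          using fun_cong[OF that, of n] by simp
        moreover have "fun_upd y n (x n) = x" by (rule x_eq[symmetric])
        ultimately have "(fun_upd \<omega> n a = x) = (\<omega> = y \<and> a = x n)" for a
          by metis
        then show ?thesis using xn by auto
      qed
      finally show ?thesis
        using xn A hist by (cases "\<omega> = y") (simp_all add: emeasure_point_measure_finite)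
    qed
    have "emeasure (C 0 (Suc n) (\<lambda>x. undefined)) {x}
        = (\<integral>\<^sup>+\<omega>. emeasure (eP n \<omega>) {x} \<partial>C 0 n (\<lambda>x. undefined))"
    proof -
      have "sets (C 0 n (\<lambda>x. undefined)) = sets (PiM {0..<n} ?M)"
        by (subst sets_C) (auto simp: space_PiM)
      then have "measurable (C 0 n (\<lambda>x. undefined)) (subprob_algebra (PiM {0..<Suc n} ?M))
          = measurable (PiM {0..<n} ?M) (subprob_algebra (PiM {0..<Suc n} ?M))"
        by (rule measurable_cong_sets) (rule refl)
      then have "eP n \<in> measurable (C 0 n (\<lambda>x. undefined)) (subprob_algebra (PiM {0..<Suc n} ?M))"
        using measurable_eP[of n] by (simp only:)
      then show ?thesis
        unfolding C.simps add_0 using mem y sC by (intro emeasure_bind) auto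
    qed
    also have "\<dots> = (\<integral>\<^sup>+\<omega>. ennreal (k (map x [0..<n]) (x n)) * indicator {y} \<omega> \<partial>C 0 n (\<lambda>x. undefined))"
      by (intro nn_integral_cong) (simp add: sC eP)
    also have "\<dots> = ennreal (k (map x [0..<n]) (x n)) * emeasure (C 0 n (\<lambda>x. undefined)) {y}"
      using y by (subst nn_integral_cmult_indicator) (auto simp: ssC)
    also have "emeasure (C 0 n (\<lambda>x. undefined)) {y} = ennreal (\<Prod>t<n. k (map y [0..<t]) (y t))"
      by (rule Suc.IH[OF y])
    also have "(\<Prod>t<n. k (map y [0..<t]) (y t)) = (\<Prod>t<n. k (map x [0..<t]) (x t))"
      by (intro prod.cong refl arg_cong2[where f=k]) (auto simp: y_def)
    finally show ?case
      using nn by (simp add: ennreal_mult' prod_nonneg mult.commute)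
  qed
  fix h assume h: "set h \<subseteq> A"
  define n where "n = length h"
  define x where "x = restrict ((!) h) {0..<n}"
  have x: "x \<in> PiE {0..<n} (\<lambda>_. A)" using h by (auto simp: x_def n_def subset_eq)
  have mem: "{x} \<in> sets (PiM {0..<n} ?M)" using x A by (simp add: sets_PiM_count_space)
  have set_eq: "{\<omega> \<in> space (path_law A k). map \<omega> [0..<length h] = h} = PF.emb UNIV {0..<n} {x}"
  proof -
    have "(map \<omega> [0..<length h] = h) = (\<forall>i<n. \<omega> i = h ! i)" for \<omega>
      unfolding n_def by (subst list_eq_iff_nth_eq) simp
    moreover have "(restrict \<omega> {0..<n} = x) = (\<forall>i<n. \<omega> i = h ! i)" for \<omega>
    proof
      assume eq: "restrict \<omega> {0..<n} = x"
      have "\<omega> i = h ! i" if "i < n" for i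
        using fun_cong[OF eq, of i] that by (simp add: x_def)
      then show "\<forall>i<n. \<omega> i = h ! i" by blast
    next
      show "\<forall>i<n. \<omega> i = h ! i \<Longrightarrow> restrict \<omega> {0..<n} = x"
        unfolding x_def by (intro restrict_ext) simp
    qed
    ultimately show ?thesis
      unfolding sp by (auto simp: prod_emb_def Pi_iff)
  qed
  have "emeasure PF.lim (PF.emb UNIV {0..<n} {x}) = emeasure (CI {0..<n}) {x}"
    by (rule lim) (use mem in auto)
  also have "\<dots> = emeasure (C 0 n (\<lambda>_. undefined)) (PF.emb {0..<n} {0..<n} {x})"
    by (rule emeasure_CI) (use mem in auto)
  also have "PF.emb {0..<n} {0..<n} {x} = {x}"
    using x by (auto simp: prod_emb_def PiE_restrict)
  also have "emeasure (C 0 n (\<lambda>_. undefined)) {x} = ennreal (\<Prod>t<n. k (map x [0..<t]) (x t))"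
    by (rule C[OF x])
  also have "(\<Prod>t<n. k (map x [0..<t]) (x t)) = (\<Prod>t<n. k (take t h) (h ! t))"
    by (intro prod.cong refl arg_cong2[where f=k] nth_equalityI) (simp_all add: x_def n_def)
  finally have "emeasure (path_law A k) {\<omega> \<in> space (path_law A k). map \<omega> [0..<length h] = h}
      = ennreal (\<Prod>t<n. k (take t h) (h ! t))"
    unfolding set_eq by (simp add: law)
  moreover have "0 \<le> (\<Prod>t<n. k (take t h) (h ! t))"
  proof (intro prod_nonneg ballI)
    fix t assume "t \<in> {..<n}"
    then have "take t h \<in> lists A" "h ! t \<in> A"
      using h by (auto simp: n_def dest: in_set_takeD)
    then show "0 \<le> k (take t h) (h ! t)"
      using k by (auto simp: causal_kernel_def distribution_on_def)
  qed
  ultimately show "measure (path_law A k) {\<omega> \<in> space (path_law A k). map \<omega> [0..<length h] = h}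
      = (\<Prod>t<length h. k (take t h) (h ! t))"
    by (simp add: measure_def n_def)
qed

definition battery_step :: "('x \<Rightarrow> real) \<Rightarrow> real \<Rightarrow> real \<Rightarrow> 'x \<times> real \<Rightarrow> real" where
  "battery_step \<phi> Bmax b = (\<lambda>(x, e). min (b + e) Bmax - \<phi> x)"

text \<open>\<open>battery \<phi> Bmax h\<close> is \<open>b\<^bsub>n+1\<^esub>\<close>, where \<open>h\<close> lists the pairs
  \<open>(x\<^sub>1, e\<^sub>1), \<dots>, (x\<^sub>n, e\<^sub>n)\<close>.\<close>

definition battery :: "('x \<Rightarrow> real) \<Rightarrow> real \<Rightarrow> ('x \<times> real) list \<Rightarrow> real" where
  "battery \<phi> Bmax h = foldl (battery_step \<phi> Bmax) Bmax h"

definition feasible :: "('x \<Rightarrow> real) \<Rightarrow> real \<Rightarrow> real set \<Rightarrow> nat \<Rightarrow> ('x \<times> real) list set" where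
  "feasible \<phi> Bmax \<E> n =
     {h. length h = n \<and> set h \<subseteq> UNIV \<times> \<E> \<and>
         (\<forall>t<n. \<phi> (fst (h ! t)) \<le> min (battery \<phi> Bmax (take t h) + snd (h ! t)) Bmax)}"

definition feasible_inf :: "('x \<Rightarrow> real) \<Rightarrow> real \<Rightarrow> real set \<Rightarrow> (nat \<Rightarrow> 'x \<times> real) set" where
  "feasible_inf \<phi> Bmax \<E> = {\<omega>. \<forall>n\<ge>1. map \<omega> [0..<n] \<in> feasible \<phi> Bmax \<E> n}"

definition reachable :: "('x \<Rightarrow> real) \<Rightarrow> real \<Rightarrow> real set \<Rightarrow> real set" where
  "reachable \<phi> Bmax \<E> = (\<Union>n. battery \<phi> Bmax ` feasible \<phi> Bmax \<E> n)"

text \<open>This is the library's \<open>\<H>(X)\<close> (\<open>entropy_Pow\<close> of locale \<open>information_space\<close>) to base 2.\<close>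

definition shannon_entropy :: "'a measure \<Rightarrow> ('a \<Rightarrow> 'b) \<Rightarrow> real" where
  "shannon_entropy M X = prob_space.entropy M 2 (count_space (X ` space M)) X"

definition admissible ::
    "('x::finite \<Rightarrow> real) \<Rightarrow> real \<Rightarrow> real set \<Rightarrow> (('x \<times> real) list \<Rightarrow> 'x \<times> real \<Rightarrow> real) set" where
  "admissible \<phi> Bmax \<E> =
     {p. causal_kernel (UNIV \<times> \<E>) p \<and>
         (AE \<omega> in path_law (UNIV \<times> \<E>) p. \<omega> \<in> feasible_inf \<phi> Bmax \<E>)}"

definition entropy_rate ::
    "real set \<Rightarrow> real \<Rightarrow> (('x::finite \<times> real) list \<Rightarrow> 'x \<times> real \<Rightarrow> real) \<Rightarrow> ereal" where
  "entropy_rate \<E> \<rho> p =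
     (let M = path_law (UNIV \<times> \<E>) p in
      liminf (\<lambda>n. ereal (1 / real n *
        (shannon_entropy M (\<lambda>\<omega>. map (\<lambda>t. fst (\<omega> t)) [0..<n])
          - \<rho> * (\<Sum>t<n. \<integral>\<omega>. snd (\<omega> t) \<partial>M)))))"

definition J_M :: "('x::finite \<Rightarrow> real) \<Rightarrow> real \<Rightarrow> real set \<Rightarrow> real \<Rightarrow> ereal" where
  "J_M \<phi> Bmax \<E> \<rho> = (SUP p \<in> admissible \<phi> Bmax \<E>. entropy_rate \<E> \<rho> p)"

text \<open>Conditional distributions of the form \<open>p(x\<^sub>t, e\<^sub>t | x\<^bsup>t-1\<^esup>, b\<^sub>t)\<close>; the time \<open>t\<close> is
  determined by the length of \<open>x\<^bsup>t-1\<^esup>\<close>.\<close>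

definition battery_based ::
    "('x \<Rightarrow> real) \<Rightarrow> real \<Rightarrow> (('x \<times> real) list \<Rightarrow> 'x \<times> real \<Rightarrow> real) set" where
  "battery_based \<phi> Bmax = {p. \<exists>q. \<forall>h. p h = q (map fst h) (battery \<phi> Bmax h)}"

type_synonym state = "real \<Rightarrow> real"

text \<open>\<open>u b (x, e)\<close> stands for \<open>u(x, e | b)\<close>.\<close>

type_synonym 'x action = "real \<Rightarrow> 'x \<times> real \<Rightarrow> real"

definition actions :: "('x::finite \<Rightarrow> real) \<Rightarrow> real \<Rightarrow> real set \<Rightarrow> 'x action set" where
  "actions \<phi> Bmax \<E> =
     {u. \<forall>b\<in>reachable \<phi> Bmax \<E>. distribution_on (UNIV \<times> \<E>) (u b) \<and>
           (\<forall>x. \<forall>e\<in>\<E>. \<phi> x > min (b + e) Bmax \<longrightarrow> u b (x, e) = 0)}"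

definition disturbance_prob ::
    "('x \<Rightarrow> real) \<Rightarrow> real \<Rightarrow> real set \<Rightarrow> state \<Rightarrow> 'x action \<Rightarrow> 'x \<Rightarrow> real" where
  "disturbance_prob \<phi> Bmax \<E> s u w =
     (\<Sum>e\<in>\<E>. \<Sum>b\<in>reachable \<phi> Bmax \<E>. s b * u b (w, e))"

text \<open>After a disturbance of conditional probability \<open>0\<close> the defining quotient is \<open>0/0\<close>; the
  state is then left unchanged, so that it always remains a distribution.\<close>

definition next_state ::
    "('x \<Rightarrow> real) \<Rightarrow> real \<Rightarrow> real set \<Rightarrow> state \<Rightarrow> 'x action \<Rightarrow> 'x \<Rightarrow> state" where
  "next_state \<phi> Bmax \<E> s u w b' =
     (if disturbance_prob \<phi> Bmax \<E> s u w = 0 then s b'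
      else (\<Sum>e\<in>\<E>. \<Sum>b\<in>reachable \<phi> Bmax \<E>.
              s b * u b (w, e) * of_bool (b' = min (b + e) Bmax - \<phi> w))
           / (\<Sum>e\<in>\<E>. \<Sum>b\<in>reachable \<phi> Bmax \<E>. s b * u b (w, e)))"

definition reward ::
    "('x::finite \<Rightarrow> real) \<Rightarrow> real \<Rightarrow> real set \<Rightarrow> real \<Rightarrow> state \<Rightarrow> 'x action \<Rightarrow> real" where
  "reward \<phi> Bmax \<E> \<rho> s u =
     (\<Sum>x\<in>UNIV. \<Sum>e\<in>\<E>. \<Sum>b\<in>reachable \<phi> Bmax \<E>.
        s b * u b (x, e) *
        (- log 2 (\<Sum>e'\<in>\<E>. \<Sum>b'\<in>reachable \<phi> Bmax \<E>. s b' * u b' (x, e')) - \<rho> * e))"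

definition policies :: "('x::finite \<Rightarrow> real) \<Rightarrow> real \<Rightarrow> real set \<Rightarrow> ('x list \<Rightarrow> 'x action) set" where
  "policies \<phi> Bmax \<E> = {\<mu>. \<forall>ws. \<mu> ws \<in> actions \<phi> Bmax \<E>}"

text \<open>\<open>mdp_state \<phi> Bmax \<E> \<mu> w t\<close> is \<open>s\<^bsub>t+1\<^esub>\<close> for the disturbance sequence
  \<open>w 0, w 1, \<dots>\<close>; it depends only on \<open>w 0, \<dots>, w (t - 1)\<close>.\<close>

primrec mdp_state ::
    "('x \<Rightarrow> real) \<Rightarrow> real \<Rightarrow> real set \<Rightarrow> ('x list \<Rightarrow> 'x action) \<Rightarrow> (nat \<Rightarrow> 'x) \<Rightarrow> nat \<Rightarrow> state" where
  "mdp_state \<phi> Bmax \<E> \<mu> w 0 = (\<lambda>b. of_bool (b = Bmax))"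
| "mdp_state \<phi> Bmax \<E> \<mu> w (Suc t) =
     next_state \<phi> Bmax \<E> (mdp_state \<phi> Bmax \<E> \<mu> w t) (\<mu> (map w [0..<t])) (w t)"

definition disturbance_kernel ::
    "('x \<Rightarrow> real) \<Rightarrow> real \<Rightarrow> real set \<Rightarrow> ('x list \<Rightarrow> 'x action) \<Rightarrow> 'x list \<Rightarrow> 'x \<Rightarrow> real" where
  "disturbance_kernel \<phi> Bmax \<E> \<mu> ws =
     disturbance_prob \<phi> Bmax \<E> (mdp_state \<phi> Bmax \<E> \<mu> ((!) ws) (length ws)) (\<mu> ws)"

lemma Bmax_reachable: "Bmax \<in> reachable \<phi> Bmax \<E>"
proof -
  have "[] \<in> feasible \<phi> Bmax \<E> 0" by (simp add: feasible_def)
  then show ?thesis by (force simp: reachable_def battery_def)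
qed

lemma battery_step_reachable:
  assumes "b \<in> reachable \<phi> Bmax \<E>" "e \<in> \<E>" "\<phi> x \<le> min (b + e) Bmax"
  shows "min (b + e) Bmax - \<phi> x \<in> reachable \<phi> Bmax \<E>"
proof -
  obtain n h where h: "h \<in> feasible \<phi> Bmax \<E> n" "b = battery \<phi> Bmax h"
    using assms(1) by (auto simp: reachable_def)
  have "h @ [(x, e)] \<in> feasible \<phi> Bmax \<E> (Suc n)"
    using h assms(2,3) by (auto simp: feasible_def nth_append less_Suc_eq)
  moreover have "battery \<phi> Bmax (h @ [(x, e)]) = min (b + e) Bmax - \<phi> x"
    by (simp add: h(2) battery_def battery_step_def)
  ultimately show ?thesis by (force simp: reachable_def)
qed

lemma
  fixes \<phi> :: "'x::finite \<Rightarrow> real"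
  assumes fin: "finite \<E>" "finite (reachable \<phi> Bmax \<E>)"
    and s: "distribution_on (reachable \<phi> Bmax \<E>) s" and u: "u \<in> actions \<phi> Bmax \<E>"
  shows disturbance_prob_distribution: "distribution_on UNIV (disturbance_prob \<phi> Bmax \<E> s u)"
    and next_state_distribution:
      "distribution_on (reachable \<phi> Bmax \<E>) (next_state \<phi> Bmax \<E> s u w)"
proof -
  let ?R = "reachable \<phi> Bmax \<E>"
  have nn: "0 \<le> s b * u b (x, e)" if "b \<in> ?R" "e \<in> \<E>" for b x e
    using that s u by (auto simp: distribution_on_def actions_def)
  then have d_nn: "0 \<le> disturbance_prob \<phi> Bmax \<E> s u x" for x
    unfolding disturbance_prob_def by (intro sum_nonneg) auto
  have u1: "(\<Sum>x\<in>UNIV. \<Sum>e\<in>\<E>. u b (x, e)) = 1" if "b \<in> ?R" for b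
    using that u by (simp add: distribution_on_def actions_def sum.cartesian_product)
  have "(\<Sum>x\<in>UNIV. disturbance_prob \<phi> Bmax \<E> s u x)
      = (\<Sum>x\<in>UNIV. \<Sum>b\<in>?R. \<Sum>e\<in>\<E>. s b * u b (x, e))"
    unfolding disturbance_prob_def by (intro sum.cong refl sum.swap)
  also have "\<dots> = (\<Sum>b\<in>?R. \<Sum>x\<in>UNIV. \<Sum>e\<in>\<E>. s b * u b (x, e))"
    by (rule sum.swap)
  also have "\<dots> = (\<Sum>b\<in>?R. s b * (\<Sum>x\<in>UNIV. \<Sum>e\<in>\<E>. u b (x, e)))"
    by (simp add: sum_distrib_left)
  also have "\<dots> = (\<Sum>b\<in>?R. s b)"
    by (intro sum.cong) (simp_all add: u1)
  finally show "distribution_on UNIV (disturbance_prob \<phi> Bmax \<E> s u)"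
    using s d_nn by (simp add: distribution_on_def)
  let ?d = "disturbance_prob \<phi> Bmax \<E> s u w"
  let ?N = "\<lambda>b'. \<Sum>e\<in>\<E>. \<Sum>b\<in>?R. s b * u b (w, e) * of_bool (b' = min (b + e) Bmax - \<phi> w)"
  show "distribution_on ?R (next_state \<phi> Bmax \<E> s u w)"
  proof (cases "?d = 0")
    case True
    then have "next_state \<phi> Bmax \<E> s u w = s" by (simp add: next_state_def fun_eq_iff)
    with s show ?thesis by simp
  next
    case False
    have next_eq: "next_state \<phi> Bmax \<E> s u w b' = ?N b' / ?d" for b'
      using False by (simp add: next_state_def disturbance_prob_def)
    have inner: "(\<Sum>b'\<in>?R. s b * u b (w, e) * of_bool (b' = min (b + e) Bmax - \<phi> w)) = s b * u b (w, e)"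
      if b: "b \<in> ?R" and e: "e \<in> \<E>" for b e
    proof (cases "\<phi> w \<le> min (b + e) Bmax")
      case True
      have "(\<Sum>b'\<in>?R. of_bool (b' = min (b + e) Bmax - \<phi> w)) = (1 :: real)"
        using battery_step_reachable[of b \<phi> Bmax \<E> e w, OF b e True] fin(2)
        by (simp add: of_bool_def sum.delta)
      then show ?thesis by (simp only: sum_distrib_left[symmetric] mult_1_right)
    next
      case False
      then have "u b (w, e) = 0" using u b e by (auto simp: actions_def not_le)
      then show ?thesis by simp
    qed
    have "(\<Sum>b'\<in>?R. ?N b')
        = (\<Sum>e\<in>\<E>. \<Sum>b'\<in>?R. \<Sum>b\<in>?R. s b * u b (w, e) * of_bool (b' = min (b + e) Bmax - \<phi> w))"
      by (rule sum.swap)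
    also have "\<dots> = (\<Sum>e\<in>\<E>. \<Sum>b\<in>?R. \<Sum>b'\<in>?R. s b * u b (w, e) * of_bool (b' = min (b + e) Bmax - \<phi> w))"
      by (intro sum.cong refl sum.swap)
    also have "\<dots> = (\<Sum>e\<in>\<E>. \<Sum>b\<in>?R. s b * u b (w, e))"
      by (intro sum.cong refl) (rule inner)
    also have "\<dots> = ?d"
      by (simp add: disturbance_prob_def)
    finally have "(\<Sum>b'\<in>?R. next_state \<phi> Bmax \<E> s u w b') = 1"
      unfolding next_eq using False by (simp flip: sum_divide_distrib)
    moreover have "0 \<le> ?N b'" for b'
      using nn by (intro sum_nonneg mult_nonneg_nonneg[OF nn]) auto
    ultimately show ?thesis
      using d_nn by (simp add: distribution_on_def next_eq)
  qed
qed

lemma mdp_state_distribution: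
  fixes \<phi> :: "'x::finite \<Rightarrow> real"
  assumes "finite \<E>" "finite (reachable \<phi> Bmax \<E>)" "\<mu> \<in> policies \<phi> Bmax \<E>"
  shows "distribution_on (reachable \<phi> Bmax \<E>) (mdp_state \<phi> Bmax \<E> \<mu> w t)"
proof (induction t)
  case 0
  show ?case
    using assms(2) Bmax_reachable[of Bmax \<phi> \<E>] by (simp add: distribution_on_def of_bool_def sum.delta)
next
  case (Suc t)
  then show ?case
    using assms by (simp add: next_state_distribution policies_def)
qed

lemma causal_kernel_disturbance_kernel:
  fixes \<phi> :: "'x::finite \<Rightarrow> real"
  assumes "finite \<E>" "finite (reachable \<phi> Bmax \<E>)" "\<mu> \<in> policies \<phi> Bmax \<E>"
  shows "causal_kernel UNIV (disturbance_kernel \<phi> Bmax \<E> \<mu>)"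
  unfolding causal_kernel_def disturbance_kernel_def
proof
  fix ws :: "'x list"
  have "\<mu> ws \<in> actions \<phi> Bmax \<E>" using assms(3) by (simp add: policies_def)
  then show "distribution_on UNIV
      (disturbance_prob \<phi> Bmax \<E> (mdp_state \<phi> Bmax \<E> \<mu> ((!) ws) (length ws)) (\<mu> ws))"
    by (intro disturbance_prob_distribution mdp_state_distribution assms)
qed

definition average_reward ::
    "('x::finite \<Rightarrow> real) \<Rightarrow> real \<Rightarrow> real set \<Rightarrow> real \<Rightarrow> ('x list \<Rightarrow> 'x action) \<Rightarrow> ereal" where
  "average_reward \<phi> Bmax \<E> \<rho> \<mu> =
     liminf (\<lambda>n. ereal (1 / real n *
       (\<Sum>t<n. \<integral>w. reward \<phi> Bmax \<E> \<rho> (mdp_state \<phi> Bmax \<E> \<mu> w t) (\<mu> (map w [0..<t]))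
          \<partial>path_law UNIV (disturbance_kernel \<phi> Bmax \<E> \<mu>))))"

end

theory Submission
  imports Defs
begin

text \<open>The charger knows past letters and energies, but the letters and the battery level are all
  that matters: replacing the law of \<open>(x\<^sub>t, e\<^sub>t)\<close> given the full past by its conditional law given
  \<open>(x\<^bsup>t-1\<^esup>, b\<^sub>t)\<close> leaves the joint mass of \<open>(x\<^bsup>t-1\<^esup>, b\<^sub>t, x\<^sub>t, e\<^sub>t)\<close> unchanged, hence
  also the entropy of the letters and the expected energy. That conditional law is an MDP policy
  with the letters as disturbances, whose state is the posterior of the battery level given the
  letters. By the chain rule, the expected reward at time \<open>t\<close> is the entropy increment minus the
  energy cost, so the two objectives agree for every horizon \<open>n\<close>, already before the limit.\<close>

section \<open>Laws of finite prefixes under the path measure\<close>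

definition words :: "'a set \<Rightarrow> nat \<Rightarrow> 'a list set" where
  "words A n = {h. set h \<subseteq> A \<and> length h = n}"

text \<open>For \<open>h\<close> over the alphabet this is the probability that the random sequence
  starts with \<open>h\<close>, by \<open>measure_path_law_prefix\<close>.\<close>

definition path_prob :: "('a list \<Rightarrow> 'a \<Rightarrow> real) \<Rightarrow> 'a list \<Rightarrow> real" where
  "path_prob k h = (\<Prod>t<length h. k (take t h) (h ! t))"

lemma finite_words [simp]: "finite A \<Longrightarrow> finite (words A n)"
  by (simp add: words_def finite_lists_length_eq)

lemma words_0 [simp]: "words A 0 = {[]}"
  by (auto simp: words_def)

text \<open>Words grow at the end because a kernel reads the whole prefix before the new letter;
  this matches \<open>path_prob_snoc\<close>.\<close>

lemma sum_words_Suc: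
  "(\<Sum>h\<in>words A (Suc n). f h) = (\<Sum>h\<in>words A n. \<Sum>a\<in>A. f (h @ [a]))"
proof -
  have "words A (Suc n) = (\<lambda>(h, a). h @ [a]) ` (words A n \<times> A)"
  proof (intro subset_antisym subsetI)
    fix h assume "h \<in> words A (Suc n)"
    then have "h \<noteq> []" "set h \<subseteq> A" "length h = Suc n" by (auto simp: words_def)
    then show "h \<in> (\<lambda>(h, a). h @ [a]) ` (words A n \<times> A)"
      by (cases h rule: rev_cases) (auto simp: words_def)
  qed (auto simp: words_def)
  moreover have "inj_on (\<lambda>(h, a). h @ [a]) (words A n \<times> A)"
    by (auto simp: inj_on_def)
  ultimately show ?thesis
    by (simp add: sum.reindex sum.cartesian_product case_prod_unfold comp_def)
qed

lemma path_prob_Nil [simp]: "path_prob k [] = 1"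
  by (simp add: path_prob_def)

lemma path_prob_snoc [simp]: "path_prob k (h @ [a]) = path_prob k h * k h a"
proof -
  have "(\<Prod>t<length h. k (take t (h @ [a])) ((h @ [a]) ! t)) = path_prob k h"
    unfolding path_prob_def by (intro prod.cong) (auto simp: nth_append)
  then show ?thesis by (simp add: path_prob_def)
qed

lemma causal_kernel_nonneg:
  "causal_kernel A k \<Longrightarrow> set h \<subseteq> A \<Longrightarrow> a \<in> A \<Longrightarrow> 0 \<le> k h a"
  by (auto simp: causal_kernel_def distribution_on_def in_lists_conv_set subset_eq)

lemma causal_kernel_sum:
  "causal_kernel A k \<Longrightarrow> set h \<subseteq> A \<Longrightarrow> (\<Sum>a\<in>A. k h a) = 1"
  by (auto simp: causal_kernel_def distribution_on_def in_lists_conv_set subset_eq)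

lemma path_prob_nonneg:
  assumes "causal_kernel A k" "set h \<subseteq> A"
  shows "0 \<le> path_prob k h"
  using assms(2) by (induction h rule: rev_induct) (auto simp: causal_kernel_nonneg[OF assms(1)])

lemma map_upt_eq_iff: "map \<omega> [0..<length h] = h \<longleftrightarrow> (\<forall>i\<in>{..<length h}. \<omega> i = h ! i)"
  by (subst list_eq_iff_nth_eq) auto

text \<open>A cylinder is a finite intersection of events on single coordinates.\<close>

lemma sets_path_law_prefix:
  assumes "finite A" "causal_kernel A k"
  shows "{\<omega> \<in> space (path_law A k). map \<omega> [0..<length h] = h} \<in> sets (path_law A k)"
proof -
  let ?M = "PiM UNIV (\<lambda>_::nat. count_space A)"
  have sp: "space (path_law A k) = space ?M"
    by (rule sets_eq_imp_space_eq[OF sets_path_law[OF assms]])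
  have *: "{\<omega> \<in> space ?M. \<omega> i = a} \<in> sets ?M" for i a
  proof -
    \<comment> \<open>The word \<open>h\<close> need not be over \<open>A\<close>, and only subsets
      of \<open>A\<close> are measurable in \<open>count_space A\<close>; hence the
      intersection.\<close>
    have "(\<lambda>\<omega>. \<omega> i) -` ({a} \<inter> A) \<inter> space ?M \<in> sets ?M"
      by (rule measurable_sets[OF measurable_component_singleton]) auto
    also have "(\<lambda>\<omega>. \<omega> i) -` ({a} \<inter> A) \<inter> space ?M = {\<omega> \<in> space ?M. \<omega> i = a}"
      by (auto simp: space_PiM PiE_iff)
    finally show ?thesis .
  qed
  have "{\<omega> \<in> space ?M. map \<omega> [0..<length h] = h} = {\<omega> \<in> space ?M. \<forall>i\<in>{..<length h}. \<omega> i = h ! i}"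
    by (simp only: map_upt_eq_iff)
  also have "\<dots> \<in> sets ?M"
    by (rule sets.sets_Collect_finite_All) (auto intro: *)
  finally show ?thesis
    using sp sets_path_law[OF assms] by simp
qed

text \<open>The cylinder of \<open>h\<close> has probability \<open>path_prob k h\<close>, and being
  null means having probability 0. This turns almost sure statements about sequences into statements
  about finite words.\<close>

lemma AE_path_law_prefix:
  assumes A: "finite A" "causal_kernel A k" and h: "set h \<subseteq> A"
  shows "(AE \<omega> in path_law A k. map \<omega> [0..<length h] \<noteq> h) \<longleftrightarrow> path_prob k h = 0"
proof -
  interpret prob_space "path_law A k" by (rule prob_space_path_law[OF A])
  show ?thesis
    using prob_eq_0[OF sets_path_law_prefix[OF A, of h]] measure_path_law_prefix[OF A h]
    by (auto simp: path_prob_def cong: AE_cong_simp)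
qed

text \<open>A function of the first \<open>n\<close> letters takes finitely many values: it is a
  finite combination of indicators of disjoint cylinders, integrated term by term.\<close>

lemma integral_path_law_prefix:
  fixes f :: "'a list \<Rightarrow> real"
  assumes A: "finite A" "causal_kernel A k"
  shows "(\<integral>\<omega>. f (map \<omega> [0..<n]) \<partial>path_law A k) = (\<Sum>h\<in>words A n. path_prob k h * f h)"
proof -
  let ?M = "path_law A k"
  let ?C = "\<lambda>h. {\<omega> \<in> space ?M. map \<omega> [0..<n] = h}"
  interpret prob_space ?M by (rule prob_space_path_law[OF A])
  have C: "?C h \<in> sets ?M" "measure ?M (?C h) = path_prob k h" if "h \<in> words A n" for h
    using that sets_path_law_prefix[OF A, of h] measure_path_law_prefix[OF A, of h]
    by (auto simp: words_def path_prob_def)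
  have eq: "f (map \<omega> [0..<n]) = (\<Sum>h\<in>words A n. f h * indicator (?C h) \<omega>)" if "\<omega> \<in> space ?M" for \<omega>
  proof -
    have "map \<omega> [0..<n] \<in> words A n"
      using that by (auto simp: space_path_law[OF A] words_def)
    then have "(\<Sum>h\<in>words A n. if h = map \<omega> [0..<n] then f h else 0) = f (map \<omega> [0..<n])"
      using A by simp
    moreover have "f h * indicator (?C h) \<omega> = (if h = map \<omega> [0..<n] then f h else 0)" for h
      using that by (cases "h = map \<omega> [0..<n]") (auto simp: indicator_def)
    ultimately show ?thesis by simp
  qed
  have "(\<integral>\<omega>. f (map \<omega> [0..<n]) \<partial>?M) = (\<integral>\<omega>. (\<Sum>h\<in>words A n. f h * indicator (?C h) \<omega>) \<partial>?M)"
    by (intro Bochner_Integration.integral_cong refl eq)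
  also have "\<dots> = (\<Sum>h\<in>words A n. \<integral>\<omega>. f h * indicator (?C h) \<omega> \<partial>?M)"
    by (intro Bochner_Integration.integral_sum integrable_mult_right integrable_real_indicator C)
      (auto simp: emeasure_eq_measure)
  also have "\<dots> = (\<Sum>h\<in>words A n. path_prob k h * f h)"
    using C by (intro sum.cong) (auto simp: Int_absorb2 sets.sets_into_space mult.commute)
  finally show ?thesis .
qed

text \<open>The event is the finite union of the cylinders of its words, and its probability is the
  integral of an indicator that depends on the prefix only.\<close>

lemma prob_path_law_prefix_set:
  assumes A: "finite A" "causal_kernel A k"
  shows "{\<omega> \<in> space (path_law A k). map \<omega> [0..<n] \<in> S} \<in> sets (path_law A k)"
    and "measure (path_law A k) {\<omega> \<in> space (path_law A k). map \<omega> [0..<n] \<in> S}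
      = (\<Sum>h\<in>words A n \<inter> S. path_prob k h)"
proof -
  let ?M = "path_law A k"
  interpret prob_space ?M by (rule prob_space_path_law[OF A])
  have "{\<omega> \<in> space ?M. map \<omega> [0..<n] \<in> S}
      = (\<Union>h\<in>words A n \<inter> S. {\<omega> \<in> space ?M. map \<omega> [0..<length h] = h})"
    by (auto simp: space_path_law[OF A] words_def Pi_iff)
  also have "\<dots> \<in> sets ?M"
    using A sets_path_law_prefix[OF A] by (intro sets.finite_UN) auto
  finally show m: "{\<omega> \<in> space ?M. map \<omega> [0..<n] \<in> S} \<in> sets ?M" .
  have "measure ?M {\<omega> \<in> space ?M. map \<omega> [0..<n] \<in> S}
      = (\<integral>\<omega>. indicator {\<omega> \<in> space ?M. map \<omega> [0..<n] \<in> S} \<omega> \<partial>?M)"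
    using m by (simp add: Int_absorb2 sets.sets_into_space)
  also have "\<dots> = (\<integral>\<omega>. indicator S (map \<omega> [0..<n]) \<partial>?M)"
    by (intro Bochner_Integration.integral_cong) (auto simp: indicator_def)
  also have "\<dots> = (\<Sum>h\<in>words A n \<inter> S. path_prob k h)"
    unfolding integral_path_law_prefix[OF A]
    using A by (simp add: indicator_def sum.inter_restrict if_distrib cong: if_cong)
  finally show "measure ?M {\<omega> \<in> space ?M. map \<omega> [0..<n] \<in> S}
      = (\<Sum>h\<in>words A n \<inter> S. path_prob k h)" .
qed

section \<open>Marginal law and entropy of the letters\<close>

definition fibre :: "real set \<Rightarrow> 'x list \<Rightarrow> ('x \<times> real) list set" where
  "fibre \<E> xs = {h. set h \<subseteq> UNIV \<times> \<E> \<and> map fst h = xs}"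

lemma fibre_subset_words: "fibre \<E> xs \<subseteq> words (UNIV \<times> \<E>) (length xs)"
  by (auto simp: fibre_def words_def)

lemma finite_fibre [simp]: "finite \<E> \<Longrightarrow> finite (fibre \<E> (xs :: 'x::finite list))"
  by (rule finite_subset[OF fibre_subset_words]) simp

lemma fibre_Nil [simp]: "fibre \<E> [] = {[]}"
  by (auto simp: fibre_def)

lemma sum_fibre_snoc:
  "(\<Sum>h\<in>fibre \<E> (xs @ [x]). f h) = (\<Sum>h\<in>fibre \<E> xs. \<Sum>e\<in>\<E>. f (h @ [(x, e)]))"
proof -
  have "fibre \<E> (xs @ [x]) = (\<lambda>(h, e). h @ [(x, e)]) ` (fibre \<E> xs \<times> \<E>)"
  proof (intro subset_antisym subsetI)
    fix h assume "h \<in> fibre \<E> (xs @ [x])"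
    then show "h \<in> (\<lambda>(h, e). h @ [(x, e)]) ` (fibre \<E> xs \<times> \<E>)"
      by (cases h rule: rev_cases) (auto simp: fibre_def)
  qed (auto simp: fibre_def)
  moreover have "inj_on (\<lambda>(h, e). h @ [(x, e)]) (fibre \<E> xs \<times> \<E>)"
    by (auto simp: inj_on_def)
  ultimately show ?thesis
    by (simp add: sum.reindex sum.cartesian_product case_prod_unfold comp_def)
qed

lemma sum_words_fibre:
  assumes "finite \<E>"
  shows "(\<Sum>h\<in>words (UNIV \<times> \<E>) n. f h) = (\<Sum>xs\<in>words (UNIV :: 'x::finite set) n. \<Sum>h\<in>fibre \<E> xs. f h)"
proof -
  have "words (UNIV \<times> \<E>) n = (\<Union>xs\<in>words (UNIV :: 'x set) n. fibre \<E> xs)"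
    by (auto simp: words_def fibre_def)
  then show ?thesis
    using assms by (subst sum.UNION_disjoint[symmetric]) (auto, auto simp: fibre_def)
qed

definition letter_prob :: "real set \<Rightarrow> (('x \<times> real) list \<Rightarrow> 'x \<times> real \<Rightarrow> real) \<Rightarrow> 'x list \<Rightarrow> real" where
  "letter_prob \<E> p xs = (\<Sum>h\<in>fibre \<E> xs. path_prob p h)"

text \<open>The letter word takes finitely many values, and the event of each value is determined by
  the prefix of pairs, so the entropy of a simple variable reduces to a finite sum.\<close>

lemma shannon_entropy_letters:
  fixes p :: "('x::finite \<times> real) list \<Rightarrow> 'x \<times> real \<Rightarrow> real"
  assumes \<E>: "finite \<E>" and p: "causal_kernel (UNIV \<times> \<E>) p"
  shows "shannon_entropy (path_law (UNIV \<times> \<E>) p) (\<lambda>\<omega>. map (\<lambda>t. fst (\<omega> t)) [0..<n])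
    = - (\<Sum>xs\<in>words UNIV n. letter_prob \<E> p xs * log 2 (letter_prob \<E> p xs))"
proof -
  let ?A = "UNIV \<times> \<E> :: ('x \<times> real) set" and ?M = "path_law (UNIV \<times> \<E>) p"
  let ?X = "\<lambda>\<omega>. map (\<lambda>t. fst (\<omega> t)) [0..<n]"
  have A: "finite ?A" using \<E> by simp
  interpret information_space ?M 2
    using prob_space_path_law[OF A p] by (simp add: information_space_def information_space_axioms_def)
  have X: "?X -` {xs} \<inter> space ?M = {\<omega> \<in> space ?M. map \<omega> [0..<n] \<in> fibre \<E> xs}" for xs
    by (auto simp: fibre_def space_path_law[OF A p] subset_eq Pi_iff)
  have range: "?X ` space ?M \<subseteq> words UNIV n" by (auto simp: words_def)
  have prob: "prob (?X -` {xs} \<inter> space ?M) = letter_prob \<E> p xs" if "xs \<in> words UNIV n" for xs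
  proof -
    have "fibre \<E> xs \<subseteq> words ?A n" using that fibre_subset_words by (auto simp: words_def)
    then show ?thesis
      unfolding X prob_path_law_prefix_set(2)[OF A p] letter_prob_def by (simp add: Int_absorb1)
  qed
  have fin: "finite (?X ` space ?M)" using range by (rule finite_subset) simp
  have "simple_function ?M ?X"
    unfolding simple_function_def X using fin prob_path_law_prefix_set(1)[OF A p] by simp
  then have "simple_distributed ?M ?X (\<lambda>xs. measure ?M (?X -` {xs} \<inter> space ?M))"
    by (intro simple_distributedI) auto
  then have "shannon_entropy ?M ?X
      = - (\<Sum>xs\<in>?X ` space ?M. prob (?X -` {xs} \<inter> space ?M) * log 2 (prob (?X -` {xs} \<inter> space ?M)))"
    unfolding shannon_entropy_def by (rule entropy_simple_distributed)
  \<comment> \<open>A word that is not attained has an empty event, so its term is 0 and the sum may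
    run over all words.\<close>
  also have "\<dots> = - (\<Sum>xs\<in>words UNIV n. prob (?X -` {xs} \<inter> space ?M) * log 2 (prob (?X -` {xs} \<inter> space ?M)))"
  proof -
    have "?X -` {xs} \<inter> space ?M = {}" if "xs \<notin> ?X ` space ?M" for xs
      using that by auto
    then show ?thesis
      using range by (intro arg_cong[where f=uminus] sum.mono_neutral_left) auto
  qed
  also have "\<dots> = - (\<Sum>xs\<in>words UNIV n. letter_prob \<E> p xs * log 2 (letter_prob \<E> p xs))"
    by (simp add: prob)
  finally show ?thesis .
qed

section \<open>The decision process along a word of disturbances\<close>

lemma mdp_state_cong:
  assumes "\<And>i. i < t \<Longrightarrow> w i = w' i"
  shows "mdp_state \<phi> Bmax \<E> \<mu> w t = mdp_state \<phi> Bmax \<E> \<mu> w' t"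
  using assms
proof (induction t)
  case (Suc t)
  have "map w [0..<t] = map w' [0..<t]" using Suc.prems by auto
  with Suc show ?case by (simp del: map_eq_conv)
qed simp

lemma mdp_state_prefix:
  "mdp_state \<phi> Bmax \<E> \<mu> w t = mdp_state \<phi> Bmax \<E> \<mu> ((!) (map w [0..<t])) t"
  by (rule mdp_state_cong) simp


text \<open>The MDP state as a function of a finite word, which allows induction on words. Indexing
  past the end of \<open>xs\<close> is harmless, since the state reads only the first
  \<open>length xs\<close> disturbances.\<close>

definition letters_state ::
    "('x::finite \<Rightarrow> real) \<Rightarrow> real \<Rightarrow> real set \<Rightarrow> ('x list \<Rightarrow> 'x action) \<Rightarrow> 'x list \<Rightarrow> state" where
  "letters_state \<phi> Bmax \<E> \<mu> xs = mdp_state \<phi> Bmax \<E> \<mu> ((!) xs) (length xs)"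

lemma letters_state_Nil: "letters_state \<phi> Bmax \<E> \<mu> [] = (\<lambda>b. of_bool (b = Bmax))"
  by (simp add: letters_state_def)

lemma letters_state_snoc:
  "letters_state \<phi> Bmax \<E> \<mu> (xs @ [x])
    = next_state \<phi> Bmax \<E> (letters_state \<phi> Bmax \<E> \<mu> xs) (\<mu> xs) x"
proof -
  have "map ((!) (xs @ [x])) [0..<length xs] = xs"
    by (subst list_eq_iff_nth_eq) (auto simp: nth_append)
  moreover have "mdp_state \<phi> Bmax \<E> \<mu> ((!) (xs @ [x])) (length xs) = letters_state \<phi> Bmax \<E> \<mu> xs"
    unfolding letters_state_def by (rule mdp_state_cong) (simp add: nth_append)
  ultimately show ?thesis by (simp add: letters_state_def)
qed

lemma disturbance_kernel_eq:
  "disturbance_kernel \<phi> Bmax \<E> \<mu> xs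
    = disturbance_prob \<phi> Bmax \<E> (letters_state \<phi> Bmax \<E> \<mu> xs) (\<mu> xs)"
  by (simp add: disturbance_kernel_def letters_state_def)

text \<open>The logarithm depends on \<open>x\<close> alone, so the sums over \<open>e\<close> and
  \<open>b\<close> in front of it collapse to the probability of the disturbance. What remains is
  the entropy of the next letter minus \<open>\<rho>\<close> times the mean energy.\<close>

lemma reward_eq:
  "reward \<phi> Bmax \<E> \<rho> s u
    = - (\<Sum>x\<in>UNIV. disturbance_prob \<phi> Bmax \<E> s u x * log 2 (disturbance_prob \<phi> Bmax \<E> s u x))
      - \<rho> * (\<Sum>x\<in>UNIV. \<Sum>e\<in>\<E>. \<Sum>b\<in>reachable \<phi> Bmax \<E>. s b * u b (x, e) * e)"
proof -
  have "reward \<phi> Bmax \<E> \<rho> s u = (\<Sum>x\<in>UNIV. \<Sum>e\<in>\<E>. \<Sum>b\<in>reachable \<phi> Bmax \<E>.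
      s b * u b (x, e) * (- log 2 (disturbance_prob \<phi> Bmax \<E> s u x)) - \<rho> * (s b * u b (x, e) * e))"
    unfolding reward_def disturbance_prob_def by (simp add: algebra_simps)
  also have "\<dots> = (\<Sum>x\<in>UNIV. disturbance_prob \<phi> Bmax \<E> s u x * (- log 2 (disturbance_prob \<phi> Bmax \<E> s u x)))
      - \<rho> * (\<Sum>x\<in>UNIV. \<Sum>e\<in>\<E>. \<Sum>b\<in>reachable \<phi> Bmax \<E>. s b * u b (x, e) * e)"
    unfolding sum_subtractf sum_distrib_left[symmetric] sum_distrib_right[symmetric]
    by (simp only: disturbance_prob_def)
  finally show ?thesis by (simp add: sum_negf)
qed

section \<open>Battery levels of feasible histories\<close>

lemma battery_Nil [simp]: "battery \<phi> Bmax [] = Bmax"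
  by (simp add: battery_def)

lemma battery_snoc [simp]:
  "battery \<phi> Bmax (h @ [(x, e)]) = min (battery \<phi> Bmax h + e) Bmax - \<phi> x"
  by (simp add: battery_def battery_step_def)

lemma feasible_Nil [simp]: "[] \<in> feasible \<phi> Bmax \<E> 0"
  by (simp add: feasible_def)

lemma feasible_snoc:
  "h @ [(x, e)] \<in> feasible \<phi> Bmax \<E> (Suc n) \<longleftrightarrow>
    h \<in> feasible \<phi> Bmax \<E> n \<and> e \<in> \<E> \<and> \<phi> x \<le> min (battery \<phi> Bmax h + e) Bmax"
  by (auto simp: feasible_def nth_append less_Suc_eq)

lemma feasible_reachable: "h \<in> feasible \<phi> Bmax \<E> n \<Longrightarrow> battery \<phi> Bmax h \<in> reachable \<phi> Bmax \<E>"
  by (auto simp: reachable_def)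

text \<open>The last constraint bounds the cost of the last letter by the amount it is subtracted
  from; the initial level is \<open>Bmax\<close>.\<close>

lemma feasible_battery_nonneg:
  assumes "h \<in> feasible \<phi> Bmax \<E> n" "0 \<le> Bmax"
  shows "0 \<le> battery \<phi> Bmax h"
proof (cases h rule: rev_cases)
  case (snoc h' a)
  with assms(1) have "n = Suc (length h')" by (simp add: feasible_def)
  with snoc assms(1) show ?thesis
    by (cases a) (simp add: feasible_snoc)
qed (simp add: assms)

lemma reachable_nonneg: "b \<in> reachable \<phi> Bmax \<E> \<Longrightarrow> 0 \<le> Bmax \<Longrightarrow> 0 \<le> b"
  by (auto simp: reachable_def feasible_battery_nonneg)

section \<open>Admissible laws and their joint masses of letters, levels and moves\<close>

locale charger =
  fixes \<phi> :: "'x::finite \<Rightarrow> real" and Bmax :: real and \<E> :: "real set"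
  assumes phi_le: "\<phi> x \<le> Bmax" and zero_letter: "\<exists>x. \<phi> x = 0"
    and finite_E: "finite \<E>" and E_nonneg: "\<E> \<subseteq> {0..Bmax}" and E_nonempty: "\<E> \<noteq> {}"
    and finite_reachable: "finite (reachable \<phi> Bmax \<E>)"
begin

abbreviation "A \<equiv> (UNIV :: 'x set) \<times> \<E>"
abbreviation "R \<equiv> reachable \<phi> Bmax \<E>"
abbreviation "bat \<equiv> battery \<phi> Bmax"

lemma Bmax_nonneg: "0 \<le> Bmax"
  using phi_le zero_letter by metis

text \<open>For fixed \<open>xs\<close> this is the unnormalised posterior of the battery level
  given the letters; \<open>move_mass\<close> adds the next pair.\<close>

definition level_mass :: "(('x \<times> real) list \<Rightarrow> 'x \<times> real \<Rightarrow> real) \<Rightarrow> 'x list \<Rightarrow> real \<Rightarrow> real" where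
  "level_mass p xs b = (\<Sum>h\<in>fibre \<E> xs. path_prob p h * of_bool (bat h = b))"

definition move_mass ::
    "(('x \<times> real) list \<Rightarrow> 'x \<times> real \<Rightarrow> real) \<Rightarrow> 'x list \<Rightarrow> real \<Rightarrow> 'x \<times> real \<Rightarrow> real" where
  "move_mass p xs b a = (\<Sum>h\<in>fibre \<E> xs. path_prob p h * of_bool (bat h = b) * p h a)"

text \<open>Almost sure feasibility, expressed on finite words; \<open>admissible_iff\<close> is the
  link.\<close>

definition supported :: "(('x \<times> real) list \<Rightarrow> 'x \<times> real \<Rightarrow> real) \<Rightarrow> bool" where
  "supported p \<longleftrightarrow> (\<forall>h. set h \<subseteq> A \<longrightarrow> path_prob p h \<noteq> 0 \<longrightarrow> h \<in> feasible \<phi> Bmax \<E> (length h))"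

text \<open>Stated without division: \<open>\<mu> xs b\<close> is the conditional law of the next pair under \<open>p\<close>, and is
  unconstrained where \<open>(xs, b)\<close> has mass \<open>0\<close>.\<close>

definition realizes :: "(('x \<times> real) list \<Rightarrow> 'x \<times> real \<Rightarrow> real) \<Rightarrow> ('x list \<Rightarrow> 'x action) \<Rightarrow> bool" where
  "realizes p \<mu> \<longleftrightarrow> (\<forall>xs. \<forall>b\<in>R. \<forall>a\<in>A. move_mass p xs b a = level_mass p xs b * \<mu> xs b a)"

lemma finite_A: "finite A"
  by (simp add: finite_E)

text \<open>An infeasible word of positive mass would be the prefix on an event of positive
  probability. Conversely, the infeasible words of one length give finitely many null events, and
  there are countably many lengths.\<close>

lemma admissible_iff: "p \<in> admissible \<phi> Bmax \<E> \<longleftrightarrow> causal_kernel A p \<and> supported p"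
proof (cases "causal_kernel A p")
  case p: True
  let ?M = "path_law A p"
  note AE_prefix = AE_path_law_prefix[OF finite_A p]
  have "(AE \<omega> in ?M. \<omega> \<in> feasible_inf \<phi> Bmax \<E>) \<longleftrightarrow> supported p"
  proof
    assume ae: "AE \<omega> in ?M. \<omega> \<in> feasible_inf \<phi> Bmax \<E>"
    show "supported p"
      unfolding supported_def
    proof (intro allI impI, rule ccontr)
      fix h assume h: "set h \<subseteq> A" "path_prob p h \<noteq> 0" "h \<notin> feasible \<phi> Bmax \<E> (length h)"
      \<comment> \<open>\<open>feasible_inf\<close> speaks of lengths \<open>n \<ge> 1\<close> only;
        the empty word is feasible anyway.\<close>
      then have "h \<noteq> []" by auto
      then have "1 \<le> length h" by (cases h) auto
      from ae have "AE \<omega> in ?M. map \<omega> [0..<length h] \<noteq> h"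
      proof eventually_elim
        case (elim \<omega>)
        then have "map \<omega> [0..<length h] \<in> feasible \<phi> Bmax \<E> (length h)"
          using \<open>1 \<le> length h\<close> unfolding feasible_inf_def by blast
        with h(3) show ?case by metis
      qed
      with h AE_prefix[of h] show False by blast
    qed
  next
    assume supp: "supported p"
    have "AE \<omega> in ?M. map \<omega> [0..<n] \<in> feasible \<phi> Bmax \<E> n" for n
    proof -
      have "AE \<omega> in ?M. \<forall>h\<in>words A n - feasible \<phi> Bmax \<E> n. map \<omega> [0..<n] \<noteq> h"
      proof (rule AE_finite_allI)
        fix h assume "h \<in> words A n - feasible \<phi> Bmax \<E> n"
        then have h: "set h \<subseteq> A" "length h = n" "h \<notin> feasible \<phi> Bmax \<E> (length h)"
          by (auto simp: words_def)
        with supp have "path_prob p h = 0" unfolding supported_def by blast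
        then show "AE \<omega> in ?M. map \<omega> [0..<n] \<noteq> h"
          using AE_prefix[OF h(1)] h(2) by simp
      qed (simp add: finite_A)
      with AE_space[of ?M] show ?thesis
      proof eventually_elim
        case (elim \<omega>)
        then have "\<omega> i \<in> A" for i
          unfolding space_path_law[OF finite_A p] by blast
        then have "map \<omega> [0..<n] \<in> words A n"
          by (simp add: words_def image_subset_iff)
        with elim show ?case by blast
      qed
    qed
    then show "AE \<omega> in ?M. \<omega> \<in> feasible_inf \<phi> Bmax \<E>"
      by (simp add: feasible_inf_def AE_all_countable)
  qed
  with p show ?thesis by (simp add: admissible_def)
qed (simp add: admissible_def)

text \<open>A history of positive mass is feasible, so its level is exactly one point of the finite
  set \<open>R\<close>; all other histories contribute 0.\<close>

lemma sum_by_level: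
  assumes "supported p"
  shows "(\<Sum>h\<in>fibre \<E> xs. path_prob p h * g h)
    = (\<Sum>b\<in>R. \<Sum>h\<in>fibre \<E> xs. path_prob p h * of_bool (bat h = b) * g h)"
proof -
  have "path_prob p h * g h = (\<Sum>b\<in>R. path_prob p h * of_bool (bat h = b) * g h)"
    if "h \<in> fibre \<E> xs" for h
  proof (cases "path_prob p h = 0")
    case False
    then have "bat h \<in> R"
      using assms that feasible_reachable by (fastforce simp: supported_def fibre_def)
    then have "(\<Sum>b\<in>R. of_bool (bat h = b)) = (1 :: real)"
      using finite_reachable by (simp add: of_bool_def)
    then show ?thesis
      by (simp flip: sum_distrib_left sum_distrib_right)
  qed simp
  then show ?thesis
    by (subst sum.swap) (rule sum.cong[OF refl])
qed

lemma letter_prob_level: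
  assumes "supported p"
  shows "letter_prob \<E> p xs = (\<Sum>b\<in>R. level_mass p xs b)"
  using sum_by_level[OF assms, of "\<lambda>_. 1" xs] by (simp add: letter_prob_def level_mass_def)

lemma sum_move_mass:
  assumes "supported p"
  shows "(\<Sum>h\<in>fibre \<E> xs. path_prob p h * p h a) = (\<Sum>b\<in>R. move_mass p xs b a)"
  using sum_by_level[OF assms, of "\<lambda>h. p h a" xs] by (simp add: move_mass_def)

lemma letter_prob_snoc:
  assumes "supported p"
  shows "letter_prob \<E> p (xs @ [x]) = (\<Sum>e\<in>\<E>. \<Sum>b\<in>R. move_mass p xs b (x, e))"
proof -
  have "letter_prob \<E> p (xs @ [x]) = (\<Sum>e\<in>\<E>. \<Sum>h\<in>fibre \<E> xs. path_prob p h * p h (x, e))"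
    unfolding letter_prob_def sum_fibre_snoc path_prob_snoc by (rule sum.swap)
  then show ?thesis by (simp add: sum_move_mass[OF assms])
qed

text \<open>The new level is a function of the old level and the new pair, so grouping histories by
  level closes the recursion. It is the Bayes update before normalisation, matching the numerator in
  \<open>next_state\<close>.\<close>

lemma level_mass_snoc:
  assumes "supported p"
  shows "level_mass p (xs @ [x]) b' =
    (\<Sum>e\<in>\<E>. \<Sum>b\<in>R. move_mass p xs b (x, e) * of_bool (b' = min (b + e) Bmax - \<phi> x))"
proof -
  have "level_mass p (xs @ [x]) b' = (\<Sum>e\<in>\<E>. \<Sum>h\<in>fibre \<E> xs.
      path_prob p h * (p h (x, e) * of_bool (b' = min (bat h + e) Bmax - \<phi> x)))"
    unfolding level_mass_def sum_fibre_snoc path_prob_snoc battery_snoc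
    by (subst sum.swap) (simp add: mult.assoc eq_commute)
  also have "\<dots> = (\<Sum>e\<in>\<E>. \<Sum>b\<in>R. \<Sum>h\<in>fibre \<E> xs. path_prob p h * of_bool (bat h = b) *
      (p h (x, e) * of_bool (b' = min (bat h + e) Bmax - \<phi> x)))"
    by (simp only: sum_by_level[OF assms])
  \<comment> \<open>On the class \<open>bat h = b\<close> the level inside the indicator may be
    replaced by \<open>b\<close>, so that the indicator leaves the sum over histories.\<close>
  also have "\<dots> = (\<Sum>e\<in>\<E>. \<Sum>b\<in>R. move_mass p xs b (x, e) * of_bool (b' = min (b + e) Bmax - \<phi> x))"
    unfolding move_mass_def sum_distrib_right by (intro sum.cong refl) auto
  finally show ?thesis .
qed

section \<open>The MDP state as posterior of the battery level\<close>

lemma level_mass_eq_0: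
  assumes "causal_kernel A p" "letter_prob \<E> p xs = 0"
  shows "level_mass p xs b = 0"
proof -
  have "\<forall>h\<in>fibre \<E> xs. path_prob p h = 0"
    using assms(2) path_prob_nonneg[OF assms(1)] unfolding letter_prob_def
    by (subst (asm) sum_nonneg_eq_0_iff) (use finite_E in \<open>auto, auto simp: fibre_def\<close>)
  then show ?thesis by (simp add: level_mass_def)
qed

text \<open>The Bayes filter: the posterior predicts the next letter through
  \<open>disturbance_kernel\<close>, and dividing the updated masses by that prediction yields the
  next posterior. Multiplied out, both claims make sense for words of mass 0 too.\<close>

lemma
  assumes p: "causal_kernel A p" and supp: "supported p" and real: "realizes p \<mu>"
  shows level_mass_eq: "level_mass p xs b = letter_prob \<E> p xs * letters_state \<phi> Bmax \<E> \<mu> xs b"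
    and letter_prob_snoc_eq:
      "letter_prob \<E> p (xs @ [x]) = letter_prob \<E> p xs * disturbance_kernel \<phi> Bmax \<E> \<mu> xs x"
proof -
  \<comment> \<open>The prediction needs the posterior at \<open>xs\<close> only, so it is available
    inside the induction that establishes the posterior.\<close>
  have step: "letter_prob \<E> p (xs @ [x]) = letter_prob \<E> p xs * disturbance_kernel \<phi> Bmax \<E> \<mu> xs x"
    if "\<And>b. level_mass p xs b = letter_prob \<E> p xs * letters_state \<phi> Bmax \<E> \<mu> xs b" for xs x
    using real by (simp add: letter_prob_snoc[OF supp] realizes_def that disturbance_kernel_eq
        disturbance_prob_def sum_distrib_left mult.assoc)
  have level: "level_mass p xs b = letter_prob \<E> p xs * letters_state \<phi> Bmax \<E> \<mu> xs b" for xs b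
  proof (induction xs arbitrary: b rule: rev_induct)
    case Nil
    then show ?case by (auto simp: level_mass_def letter_prob_def letters_state_Nil)
  next
    case (snoc x xs)
    let ?s = "letters_state \<phi> Bmax \<E> \<mu> xs" and ?d = "disturbance_kernel \<phi> Bmax \<E> \<mu> xs x"
    show ?case
    \<comment> \<open>If the extended word has mass 0, both sides vanish whatever state the MDP is
      given by convention; otherwise \<open>next_state\<close> is the genuine quotient.\<close>
    proof (cases "letter_prob \<E> p (xs @ [x]) = 0")
      case True
      then show ?thesis by (simp add: level_mass_eq_0[OF p])
    next
      case False
      then have d: "?d \<noteq> 0" by (simp add: step[OF snoc])
      have "level_mass p (xs @ [x]) b = letter_prob \<E> p xs *
          (\<Sum>e\<in>\<E>. \<Sum>c\<in>R. ?s c * \<mu> xs c (x, e) * of_bool (b = min (c + e) Bmax - \<phi> x))"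
        using real
        by (simp add: level_mass_snoc[OF supp] realizes_def snoc sum_distrib_left mult.assoc)
      also have "\<dots> = letter_prob \<E> p xs * (?d * letters_state \<phi> Bmax \<E> \<mu> (xs @ [x]) b)"
        using d by (simp add: letters_state_snoc next_state_def disturbance_kernel_eq
            flip: disturbance_prob_def)
      finally show ?thesis by (simp add: step[OF snoc])
    qed
  qed
  show "level_mass p xs b = letter_prob \<E> p xs * letters_state \<phi> Bmax \<E> \<mu> xs b"
    by (rule level)
  show "letter_prob \<E> p (xs @ [x]) = letter_prob \<E> p xs * disturbance_kernel \<phi> Bmax \<E> \<mu> xs x"
    by (rule step[OF level])
qed

lemma letter_prob_nonneg: "causal_kernel A p \<Longrightarrow> 0 \<le> letter_prob \<E> p xs"
  unfolding letter_prob_def by (intro sum_nonneg path_prob_nonneg) (auto simp: fibre_def)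

section \<open>Agreement of the two objectives at every horizon\<close>

lemma expected_energy:
  assumes p: "causal_kernel A p" and supp: "supported p" and real: "realizes p \<mu>"
  shows "(\<integral>\<omega>. snd (\<omega> t) \<partial>path_law A p) = (\<Sum>xs\<in>words UNIV t. letter_prob \<E> p xs *
    (\<Sum>x\<in>UNIV. \<Sum>e\<in>\<E>. \<Sum>b\<in>R. letters_state \<phi> Bmax \<E> \<mu> xs b * \<mu> xs b (x, e) * e))"
proof -
  \<comment> \<open>Coordinates start at 0, so the pair with index \<open>t\<close> is the last one
    of the prefix of length \<open>Suc t\<close>.\<close>
  have "(\<integral>\<omega>. snd (\<omega> t) \<partial>path_law A p) = (\<integral>\<omega>. snd (map \<omega> [0..<Suc t] ! t) \<partial>path_law A p)"
    by (simp del: upt_Suc)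
  also have "\<dots> = (\<Sum>h\<in>words A (Suc t). path_prob p h * snd (h ! t))"
    by (rule integral_path_law_prefix[OF finite_A p])
  also have "\<dots> = (\<Sum>h\<in>words A t. \<Sum>a\<in>A. path_prob p h * p h a * snd a)"
    unfolding sum_words_Suc by (intro sum.cong refl) (auto simp: words_def nth_append)
  also have "\<dots> = (\<Sum>xs\<in>words UNIV t. \<Sum>a\<in>A. (\<Sum>h\<in>fibre \<E> xs. path_prob p h * p h a) * snd a)"
    unfolding sum_words_fibre[OF finite_E] sum_distrib_right by (intro sum.cong refl sum.swap)
  also have "\<dots> = (\<Sum>xs\<in>words UNIV t. letter_prob \<E> p xs * (\<Sum>a\<in>A. \<Sum>b\<in>R.
      letters_state \<phi> Bmax \<E> \<mu> xs b * \<mu> xs b a * snd a))"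
  proof (intro sum.cong refl)
    fix xs
    \<comment> \<open>\<open>realizes\<close> splits the joint mass into level mass and action, and
      the level mass is the letter mass times the posterior.\<close>
    have "(\<Sum>a\<in>A. (\<Sum>h\<in>fibre \<E> xs. path_prob p h * p h a) * snd a)
        = (\<Sum>a\<in>A. (\<Sum>b\<in>R. letter_prob \<E> p xs * letters_state \<phi> Bmax \<E> \<mu> xs b * \<mu> xs b a) * snd a)"
      using real level_mass_eq[OF p supp real]
      by (auto intro!: sum.cong simp: sum_move_mass[OF supp] realizes_def)
    then show "(\<Sum>a\<in>A. (\<Sum>h\<in>fibre \<E> xs. path_prob p h * p h a) * snd a)
        = letter_prob \<E> p xs * (\<Sum>a\<in>A. \<Sum>b\<in>R. letters_state \<phi> Bmax \<E> \<mu> xs b * \<mu> xs b a * snd a)"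
      by (simp add: sum_distrib_left sum_distrib_right mult.assoc)
  qed
  finally have "(\<integral>\<omega>. snd (\<omega> t) \<partial>path_law A p) = \<dots>" .
  moreover have "(\<Sum>a\<in>A. f a) = (\<Sum>x\<in>UNIV. \<Sum>e\<in>\<E>. f (x, e))" for f :: "'x \<times> real \<Rightarrow> real"
    by (simp add: sum.cartesian_product)
  ultimately show ?thesis by (simp only: snd_conv)
qed

text \<open>Iterating the one-letter prediction shows that the letters under \<open>p\<close> and
  the disturbances under \<open>\<mu>\<close> have the same law.\<close>

lemma letter_prob_eq_path_prob:
  assumes "causal_kernel A p" "supported p" "realizes p \<mu>"
  shows "letter_prob \<E> p xs = path_prob (disturbance_kernel \<phi> Bmax \<E> \<mu>) xs"
  by (induction xs rule: rev_induct)
    (simp_all add: letter_prob_snoc_eq[OF assms], simp add: letter_prob_def)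

text \<open>The chain rule for entropy: \<open>d xs\<close> is the conditional law of the next
  letter given \<open>xs\<close>, so the last sum is the conditional entropy.\<close>

lemma letter_entropy_Suc:
  assumes p: "causal_kernel A p" and supp: "supported p" and real: "realizes p \<mu>"
    and \<mu>: "\<mu> \<in> policies \<phi> Bmax \<E>"
  defines "Q \<equiv> letter_prob \<E> p" and "d \<equiv> disturbance_kernel \<phi> Bmax \<E> \<mu>"
  shows "- (\<Sum>xs\<in>words UNIV (Suc n). Q xs * log 2 (Q xs))
    = - (\<Sum>xs\<in>words UNIV n. Q xs * log 2 (Q xs))
      + (\<Sum>xs\<in>words UNIV n. Q xs * - (\<Sum>x\<in>UNIV. d xs x * log 2 (d xs x)))"
proof -
  have d: "causal_kernel UNIV d"
    unfolding d_def using \<mu> finite_E finite_reachable by (simp add: causal_kernel_disturbance_kernel)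
  \<comment> \<open>The logarithm of the product splits where both factors are positive; if one of
    them is 0, every term carries a factor 0.\<close>
  have prod: "Q xs * d xs x * log 2 (Q xs * d xs x)
      = Q xs * log 2 (Q xs) * d xs x + Q xs * (d xs x * log 2 (d xs x))" for xs x
  proof (cases "Q xs = 0 \<or> d xs x = 0")
    case False
    moreover have "0 \<le> Q xs" "0 \<le> d xs x"
      using letter_prob_nonneg[OF p] causal_kernel_nonneg[OF d] by (auto simp: Q_def)
    ultimately have "log 2 (Q xs * d xs x) = log 2 (Q xs) + log 2 (d xs x)"
      by (intro log_mult_pos) auto
    then show ?thesis by (simp add: algebra_simps)
  qed auto
  have "(\<Sum>xs\<in>words UNIV (Suc n). Q xs * log 2 (Q xs))
      = (\<Sum>xs\<in>words UNIV n. \<Sum>x\<in>UNIV. Q xs * d xs x * log 2 (Q xs * d xs x))"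
    unfolding sum_words_Suc Q_def d_def by (simp add: letter_prob_snoc_eq[OF p supp real])
  also have "\<dots> = (\<Sum>xs\<in>words UNIV n. Q xs * log 2 (Q xs) * (\<Sum>x\<in>UNIV. d xs x)
      + Q xs * (\<Sum>x\<in>UNIV. d xs x * log 2 (d xs x)))"
    unfolding prod sum.distrib sum_distrib_left by (rule refl)
  also have "\<dots> = (\<Sum>xs\<in>words UNIV n. Q xs * log 2 (Q xs))
      + (\<Sum>xs\<in>words UNIV n. Q xs * (\<Sum>x\<in>UNIV. d xs x * log 2 (d xs x)))"
    using causal_kernel_sum[OF d] by (simp add: sum.distrib)
  finally show ?thesis by (simp add: sum_negf)
qed

text \<open>State and action at index \<open>t\<close> are functions of the first \<open>t\<close>
  disturbances, whose law is that of the letters.\<close>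

lemma expected_reward:
  assumes p: "causal_kernel A p" and supp: "supported p" and real: "realizes p \<mu>"
    and \<mu>: "\<mu> \<in> policies \<phi> Bmax \<E>"
  shows "(\<integral>w. reward \<phi> Bmax \<E> \<rho> (mdp_state \<phi> Bmax \<E> \<mu> w t) (\<mu> (map w [0..<t]))
      \<partial>path_law UNIV (disturbance_kernel \<phi> Bmax \<E> \<mu>))
    = (\<Sum>xs\<in>words UNIV t. letter_prob \<E> p xs * reward \<phi> Bmax \<E> \<rho> (letters_state \<phi> Bmax \<E> \<mu> xs) (\<mu> xs))"
proof -
  have state: "mdp_state \<phi> Bmax \<E> \<mu> w t = letters_state \<phi> Bmax \<E> \<mu> (map w [0..<t])" for w
    unfolding letters_state_def by simp (rule mdp_state_prefix)
  have "causal_kernel UNIV (disturbance_kernel \<phi> Bmax \<E> \<mu>)"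
    using \<mu> finite_E finite_reachable by (simp add: causal_kernel_disturbance_kernel)
  then show ?thesis
    unfolding state letter_prob_eq_path_prob[OF p supp real]
    by (rule integral_path_law_prefix[OF finite])
qed

lemma entropy_rate_eq_average_reward:
  assumes p: "causal_kernel A p" and supp: "supported p" and real: "realizes p \<mu>"
    and \<mu>: "\<mu> \<in> policies \<phi> Bmax \<E>"
  shows "entropy_rate \<E> \<rho> p = average_reward \<phi> Bmax \<E> \<rho> \<mu>"
proof -
  let ?M = "path_law A p"
  let ?Q = "letter_prob \<E> p"
  let ?H = "\<lambda>n. - (\<Sum>xs\<in>words UNIV n. ?Q xs * log 2 (?Q xs))"
  let ?r = "\<lambda>t. \<integral>w. reward \<phi> Bmax \<E> \<rho> (mdp_state \<phi> Bmax \<E> \<mu> w t) (\<mu> (map w [0..<t]))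
      \<partial>path_law UNIV (disturbance_kernel \<phi> Bmax \<E> \<mu>)"
  have reward_d: "reward \<phi> Bmax \<E> \<rho> (letters_state \<phi> Bmax \<E> \<mu> xs) (\<mu> xs)
      = - (\<Sum>x\<in>UNIV. disturbance_kernel \<phi> Bmax \<E> \<mu> xs x * log 2 (disturbance_kernel \<phi> Bmax \<E> \<mu> xs x))
        - \<rho> * (\<Sum>x\<in>UNIV. \<Sum>e\<in>\<E>. \<Sum>b\<in>R. letters_state \<phi> Bmax \<E> \<mu> xs b * \<mu> xs b (x, e) * e)" for xs
    by (simp only: reward_eq disturbance_kernel_eq)
  \<comment> \<open>In the average over words of length \<open>t\<close>, the chain rule identifies
    the entropy part of the reward with an increment of \<open>?H\<close>, and
    \<open>expected_energy\<close> identifies the cost part.\<close>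
  have "?r t = (?H (Suc t) - ?H t) - \<rho> * (\<integral>\<omega>. snd (\<omega> t) \<partial>?M)" for t
    unfolding expected_reward[OF assms] letter_entropy_Suc[OF assms] reward_d
      expected_energy[OF p supp real]
    by (simp add: right_diff_distrib sum_subtractf sum_distrib_left mult.left_commute)
  then have "(\<Sum>t<n. ?r t) = (\<Sum>t<n. ?H (Suc t) - ?H t) - \<rho> * (\<Sum>t<n. \<integral>\<omega>. snd (\<omega> t) \<partial>?M)" for n
    by (simp only: sum_subtractf sum_distrib_left)
  moreover have "(\<Sum>t<n. ?H (Suc t) - ?H t) = ?H n - ?H 0" for n
    by (rule sum_lessThan_telescope)
  moreover have "?H 0 = 0"
    \<comment> \<open>The only word of length 0 has mass 1, whose logarithm is 0, so the telescoped
      sum is exactly \<open>?H n\<close>.\<close>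
    by (simp add: letter_prob_def)
  ultimately have "(\<Sum>t<n. ?r t) = ?H n - \<rho> * (\<Sum>t<n. \<integral>\<omega>. snd (\<omega> t) \<partial>?M)" for n
    by (simp only: diff_zero)
  then show ?thesis
    unfolding entropy_rate_def average_reward_def Let_def
      shannon_entropy_letters[OF finite_E p] by (simp only:)
qed

section \<open>Passing between admissible laws and policies\<close>

lemma policy_of_admissible:
  assumes p: "causal_kernel A p" and supp: "supported p"
  shows "\<exists>\<mu>\<in>policies \<phi> Bmax \<E>. realizes p \<mu>"
proof -
  obtain x0 e0 where x0: "\<phi> x0 = 0" and e0: "e0 \<in> \<E>"
    using zero_letter E_nonempty by auto
  \<comment> \<open>Where \<open>(xs, b)\<close> has mass 0 there is no conditional law, yet an
    action is required at every level in \<open>R\<close>. The default is the free letter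
    \<open>x0\<close> with some energy \<open>e0\<close>, feasible because levels and energies are
    nonnegative.\<close>
  define \<mu> :: "'x list \<Rightarrow> 'x action" where
    "\<mu> xs b a = (if level_mass p xs b = 0 then of_bool (a = (x0, e0))
      else move_mass p xs b a / level_mass p xs b)" for xs b a
  have path_nn: "0 \<le> path_prob p h" "0 \<le> p h a" if "h \<in> fibre \<E> xs" "a \<in> A" for h xs a
    using that path_prob_nonneg[OF p] causal_kernel_nonneg[OF p] by (auto simp: fibre_def)
  have fib: "finite (fibre \<E> (xs :: 'x list))" for xs using finite_E by simp
  have A0: "(x0, e0) \<in> A" using e0 by simp
  have level_nn: "0 \<le> level_mass p xs b" for xs b
    unfolding level_mass_def by (intro sum_nonneg mult_nonneg_nonneg path_nn(1)[OF _ A0]) auto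
  have move_nn: "0 \<le> move_mass p xs b a" if "a \<in> A" for xs b a
    unfolding move_mass_def using that by (intro sum_nonneg mult_nonneg_nonneg path_nn) auto
  have move_sum: "(\<Sum>a\<in>A. move_mass p xs b a) = level_mass p xs b" for xs b
    unfolding move_mass_def level_mass_def
    by (subst sum.swap) (auto intro!: sum.cong simp: causal_kernel_sum[OF p] fibre_def
        simp flip: sum_distrib_left)
  \<comment> \<open>This gives \<open>realizes\<close> where the default action is chosen: both
    sides are 0 there.\<close>
  have move_0: "move_mass p xs b a = 0" if "level_mass p xs b = 0" for xs b a
  proof -
    have "\<forall>h\<in>fibre \<E> xs. path_prob p h * of_bool (bat h = b) = 0"
      using that path_nn(1)[OF _ A0] unfolding level_mass_def
      by (subst (asm) sum_nonneg_eq_0_iff) (use fib in auto)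
    then show ?thesis unfolding move_mass_def by (intro sum.neutral) auto
  qed
  \<comment> \<open>A nonzero term would be the mass of a history extended by \<open>(x, e)\<close>,
    which \<open>supported\<close> makes feasible.\<close>
  have move_infeasible: "move_mass p xs b (x, e) = 0"
    if "e \<in> \<E>" "\<phi> x > min (b + e) Bmax" for xs b x e
    unfolding move_mass_def
  proof (intro sum.neutral ballI)
    fix h assume h: "h \<in> fibre \<E> xs"
    show "path_prob p h * of_bool (bat h = b) * p h (x, e) = 0"
    proof (rule ccontr)
      assume "\<not> ?thesis"
      then have "path_prob p (h @ [(x, e)]) \<noteq> 0" "bat h = b" by auto
      moreover have "set (h @ [(x, e)]) \<subseteq> A" using h that(1) by (auto simp: fibre_def)
      ultimately have "h @ [(x, e)] \<in> feasible \<phi> Bmax \<E> (Suc (length h))"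
        using supp unfolding supported_def by (metis length_append_singleton)
      with that(2) \<open>bat h = b\<close> show False by (auto simp: feasible_snoc min_def split: if_splits)
    qed
  qed
  have "\<mu> xs \<in> actions \<phi> Bmax \<E>" for xs
    unfolding actions_def mem_Collect_eq
  proof (intro ballI conjI allI impI)
    fix b assume b: "b \<in> R"
    show "distribution_on A (\<mu> xs b)"
    proof (cases "level_mass p xs b = 0")
      case True
      then show ?thesis using A0 finite_A by (simp add: distribution_on_def \<mu>_def of_bool_def)
    next
      case False
      then show ?thesis
        using move_nn level_nn move_sum
        by (auto simp: distribution_on_def \<mu>_def simp flip: sum_divide_distrib)
    qed
    fix x e assume e: "e \<in> \<E>" and x: "\<phi> x > min (b + e) Bmax"
    have "(x, e) \<noteq> (x0, e0)"
      using x x0 e E_nonneg Bmax_nonneg reachable_nonneg[OF b Bmax_nonneg]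
      by (auto simp: min_def split: if_splits)
    then show "\<mu> xs b (x, e) = 0"
      using move_infeasible[OF e x] by (simp add: \<mu>_def)
  qed
  then have "\<mu> \<in> policies \<phi> Bmax \<E>" by (simp add: policies_def)
  moreover have "realizes p \<mu>"
    by (auto simp: realizes_def \<mu>_def move_0)
  ultimately show ?thesis by blast
qed

text \<open>The charger computes its level from the past and applies the policy to the letters and
  that level. All histories with the same letters and level then share one kernel value, which
  factors out of \<open>move_mass\<close>.\<close>

lemma admissible_of_policy:
  assumes \<mu>: "\<mu> \<in> policies \<phi> Bmax \<E>"
  shows "\<exists>p. causal_kernel A p \<and> supported p \<and> realizes p \<mu> \<and> p \<in> battery_based \<phi> Bmax"
proof -
  \<comment> \<open>A causal kernel must be a distribution after every history, even an infeasible
    one whose level lies outside \<open>R\<close>; there the action at the reachable level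
    \<open>Bmax\<close> is used.\<close>
  define q where "q xs b = \<mu> xs (if b \<in> R then b else Bmax)" for xs b
  define p where "p h = q (map fst h) (bat h)" for h
  have act: "distribution_on A (\<mu> xs b)" "\<And>x e. e \<in> \<E> \<Longrightarrow> \<phi> x > min (b + e) Bmax \<Longrightarrow> \<mu> xs b (x, e) = 0"
    if "b \<in> R" for xs b
    using \<mu> that by (auto simp: policies_def actions_def)
  have "causal_kernel A p"
    using act(1) Bmax_reachable[of Bmax \<phi> \<E>] by (simp add: causal_kernel_def p_def q_def)
  moreover have "supported p"
    unfolding supported_def
  proof (intro allI impI)
    fix h assume "set h \<subseteq> A" "path_prob p h \<noteq> 0"
    then show "h \<in> feasible \<phi> Bmax \<E> (length h)"
    proof (induction h rule: rev_induct)
      case (snoc a h)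
      obtain x e where a: "a = (x, e)" by (cases a)
      have h: "h \<in> feasible \<phi> Bmax \<E> (length h)" and e: "e \<in> \<E>" using snoc a by auto
      have "\<mu> (map fst h) (bat h) (x, e) \<noteq> 0"
        using snoc.prems a feasible_reachable[OF h] by (simp add: p_def q_def)
      then have "\<phi> x \<le> min (bat h + e) Bmax"
        using act(2)[OF feasible_reachable[OF h] e] by (meson not_le)
      with h e show ?case by (simp add: a feasible_snoc)
    qed simp
  qed
  moreover have "realizes p \<mu>"
    unfolding realizes_def move_mass_def level_mass_def sum_distrib_right
    by (auto intro!: sum.cong simp: p_def q_def fibre_def)
  moreover have "p \<in> battery_based \<phi> Bmax"
    unfolding battery_based_def p_def by blast
  ultimately show ?thesis by blast
qed

end

section \<open>Comparison of the three suprema\<close>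

theorem mainTheorem8:
  fixes \<phi> :: "'x::finite \<Rightarrow> real" and Bmax \<rho> :: real and \<E> :: "real set"
  assumes "\<And>x. 0 \<le> \<phi> x" and "\<And>x. \<phi> x \<le> Bmax" and "\<exists>x. \<phi> x = 0"
    and "finite \<E>" and "\<E> \<subseteq> {0..Bmax}" and "\<exists>e\<in>\<E>. 0 < e"
    and "finite (reachable \<phi> Bmax \<E>)"
    and "0 \<le> \<rho>"
  shows "J_M \<phi> Bmax \<E> \<rho> =
           (SUP p \<in> admissible \<phi> Bmax \<E> \<inter> battery_based \<phi> Bmax. entropy_rate \<E> \<rho> p) \<and>
         J_M \<phi> Bmax \<E> \<rho> =
           (SUP \<mu> \<in> policies \<phi> Bmax \<E>. average_reward \<phi> Bmax \<E> \<rho> \<mu>)"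
proof -
  interpret charger \<phi> Bmax \<E>
    using assms by unfold_locales auto
  let ?P = "admissible \<phi> Bmax \<E>" and ?B = "battery_based \<phi> Bmax"
  have "\<exists>\<mu>\<in>policies \<phi> Bmax \<E>. entropy_rate \<E> \<rho> p = average_reward \<phi> Bmax \<E> \<rho> \<mu>" if "p \<in> ?P" for p
    using that policy_of_admissible entropy_rate_eq_average_reward by (metis admissible_iff)
  then have 1: "entropy_rate \<E> \<rho> ` ?P \<subseteq> average_reward \<phi> Bmax \<E> \<rho> ` policies \<phi> Bmax \<E>"
    by auto
  have "\<exists>p\<in>?P \<inter> ?B. average_reward \<phi> Bmax \<E> \<rho> \<mu> = entropy_rate \<E> \<rho> p"
    if "\<mu> \<in> policies \<phi> Bmax \<E>" for \<mu>
    using admissible_of_policy[OF that] entropy_rate_eq_average_reward[OF _ _ _ that]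
    by (metis IntI admissible_iff)
  then have 2: "average_reward \<phi> Bmax \<E> \<rho> ` policies \<phi> Bmax \<E> \<subseteq> entropy_rate \<E> \<rho> ` (?P \<inter> ?B)"
    by auto
  have 3: "entropy_rate \<E> \<rho> ` (?P \<inter> ?B) \<subseteq> entropy_rate \<E> \<rho> ` ?P"
    by auto
  \<comment> \<open>The inclusions form a cycle, so the three sets of attained values coincide, not
    only their suprema.\<close>
  from 1 2 3 have "entropy_rate \<E> \<rho> ` ?P = entropy_rate \<E> \<rho> ` (?P \<inter> ?B)"
    "entropy_rate \<E> \<rho> ` ?P = average_reward \<phi> Bmax \<E> \<rho> ` policies \<phi> Bmax \<E>"
    by auto
  then show ?thesis
    unfolding J_M_def by simp
qed

end
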